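(* In the setting described in the context, suppose that Assumptions A0, A1 and A2 stated there hold. Further, let $u_i^h\overset{\mathcal{H}}{\rightarrow}u_i$ for $i=0,1$, with $u_1\ne u_0$ and $u_1^h\ne u_0^h$. Then for any given numbers $\epsilon>0$ and $\delta>0$ there exists a number $h_{\delta,\epsilon}>0$ such that $$k^*(\epsilon+\delta)\le k_h^*(\epsilon)\le k^*(\epsilon)$$ for every $h\in(0,h_{\delta,\epsilon}]$.
   Context: Continuous problem and algorithm. $\mathcal{H}$ is a real Hilbert space with inner product $(\cdot,\cdot)$ and norm $\|\cdot\|$, $\mathcal{F}:\mathcal{H}\to\mathbb{R}$ is twice continuously Fréchet differentiable with gradient (Riesz representative of $\mathcal{F}'$) $\mathcal{G}:\mathcal{H}\to\mathcal{H}$, and $\mathcal{G}_k:=\mathcal{G}(u_k)$. The BB gradient algorithm with initial iterates $u_0\ne u_1$ computes, for $k\ge1$ and as long as $\mathcal{G}_k\neq0$, $u_{k+1}=u_k-\frac1{\alpha_k}\mathcal{G}_k$, where $\alpha_k$ is chosen as either $\alpha_k^{BB1}=\frac{(\mathcal{S}_{k-1},\mathcal{Y}_{k-1})}{(\mathcal{S}_{k-1},\mathcal{S}_{k-1})}$ or $\alpha_k^{BB2}=\frac{(\mathcal{Y}_{k-1},\mathcal{Y}_{k-1})}{(\mathcal{S}_{k-1},\mathcal{Y}_{k-1})}$, with $\mathcal{S}_{k-1}=u_k-u_{k-1}$, $\mathcal{Y}_{k-1}=\mathcal{G}_k-\mathcal{G}_{k-1}$. It stops when $\mathcal{G}_k=0$.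 Assumption A0: $u^*$ is a local minimizer of $\mathcal{F}$, $\mathcal{F}''$ is locally Lipschitz continuous, and $\delta_{\inf}\|v\|^2\le\mathcal{F}''(u^* )(v,v)\le\delta_{\sup}\|v\|^2$ for all $v\in\mathcal{H}$ with constants $\delta_{\sup}\ge\delta_{\inf}>0$. Under these hypotheses there are positive $\zeta,\lambda_1,\lambda_2$ and $\theta<1$ such that for $u_0\neq u_1$ in the ball $\mathcal{B}_\zeta(u^* )$ the generated sequence satisfies $\|u_k-u^*\|\le\lambda_1\theta^k\|u_1-u^*\|$ and $\|\mathcal{G}_k\|\le\lambda_2\theta^k\|\mathcal{G}_1\|$ for all $k\ge1$. $\{u_k\}_k$ denotes the sequence generated by the algorithm having these properties; in particular $\|u_0-u^*\|$ and $\|u_1-u^*\|$ are sufficiently small ($<\zeta$), unless $\mathcal{F}$ is a strictly convex quadratic function $\mathcal{F}(u)=\frac12(\mathcal{A}u,u)-(b,u)$ ($\mathcal{A}$ bounded, self-adjoint, uniformly positive), in which case $u_0,u_1$ can be any elements of $\mathcal{H}$. Discrete problems. $\{\mathcal{H}^h\}_h$ is a family of finite-dimensional Hilbert spaces indexed by real $h>0$, with inner products $(\cdot,\cdot)_h$ and norms $\|\cdot\|_h$; $\mathcal{G}^h:\mathcal{H}^h\to\mathcal{H}^h$ are continuous (nonlinear) mappings; $\mathbb{P}^h:\mathcal{H}^h\to\mathcal{H}$ are linear prolongation operators. One writes $u^h\overset{\mathcal{H}}{\rightarrow}u$ if $\lim_{h\downarrow0}\|\mathbb{P}^hu^h-u\|=0$.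 Given $u_0^h,u_1^h\in\mathcal{H}^h$, the discrete sequence is $u_{k+1}^h=u_k^h-\frac1{\alpha_k^h}\mathcal{G}_k^h$, $k\ge1$, $\mathcal{G}_k^h:=\mathcal{G}^h(u_k^h)$, with $\alpha_k^h$ equal to $\alpha_k^{BB1,h}=\frac{(\mathcal{S}_{k-1}^h,\mathcal{Y}_{k-1}^h)_h}{(\mathcal{S}_{k-1}^h,\mathcal{S}_{k-1}^h)_h}$ or $\alpha_k^{BB2,h}=\frac{(\mathcal{Y}_{k-1}^h,\mathcal{Y}_{k-1}^h)_h}{(\mathcal{S}_{k-1}^h,\mathcal{Y}_{k-1}^h)_h}$, where $\mathcal{S}_{k-1}^h=u_k^h-u_{k-1}^h$, $\mathcal{Y}_{k-1}^h=\mathcal{G}_k^h-\mathcal{G}_{k-1}^h$. At each $k$ the same formula (BB1 or BB2) is used for the discrete as for the continuous sequence. Assumption A1: if $u^h\overset{\mathcal{H}}{\rightarrow}u$ and $z^h\overset{\mathcal{H}}{\rightarrow}z$ for $u,z\in\mathcal{H}$, then $\lim_{h\downarrow0}(u^h,z^h)_h=(u,z)$. Assumption A2: $\mathcal{G}(u^* )=0$, and if $u^h\overset{\mathcal{H}}{\rightarrow}u$ with $u$ in a neighborhood of $u^*$ (understood to contain the iterates $u_k$), then $\mathcal{G}^h(u^h)\overset{\mathcal{H}}{\rightarrow}\mathcal{G}(u)$. Iteration counts (with $\mathbb{N}=\{1,2,\dots\}$): $k^*(\epsilon):=\min\{k\in\mathbb{N}:\|\mathcal{G}_k\|<\epsilon\}$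 and $k_h^*(\epsilon):=\min\{k\in\mathbb{N}:\|\mathcal{G}_k^h\|_h<\epsilon\}$. *)

theory Defs
  imports "HOL-Analysis.Analysis" "HOL-Library.Extended_Nat"
begin

section \<open>The continuous problem\<close>

(* F1 and F2 are the first and second Frechet derivatives, G is the Riesz representative of F1;
   all three are uniquely determined by F. *)

definition C2_with_gradient ::
  "('a::{real_inner,complete_space} \<Rightarrow> real) \<Rightarrow> ('a \<Rightarrow> ('a \<Rightarrow>\<^sub>L real)) \<Rightarrow>
   ('a \<Rightarrow> ('a \<Rightarrow>\<^sub>L ('a \<Rightarrow>\<^sub>L real))) \<Rightarrow> ('a \<Rightarrow> 'a) \<Rightarrow> bool"
  where
  "C2_with_gradient F F1 F2 G \<longleftrightarrow>
     (\<forall>u. (F has_derivative blinfun_apply (F1 u)) (at u)) \<and>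
     (\<forall>u. (F1 has_derivative blinfun_apply (F2 u)) (at u)) \<and>
     continuous_on UNIV F2 \<and>
     (\<forall>u v. blinfun_apply (F1 u) v = G u \<bullet> v)"

definition assumption_A0 ::
  "('a::{real_inner,complete_space} \<Rightarrow> real) \<Rightarrow> ('a \<Rightarrow> ('a \<Rightarrow>\<^sub>L ('a \<Rightarrow>\<^sub>L real))) \<Rightarrow> 'a \<Rightarrow> bool"
  where
  "assumption_A0 F F2 ustar \<longleftrightarrow>
     (\<forall>\<^sub>F u in nhds ustar. F ustar \<le> F u) \<and>
     (\<forall>u. \<exists>r>0. \<exists>L. L-lipschitz_on (cball u r) F2) \<and>
     (\<exists>\<delta>inf \<delta>sup. 0 < \<delta>inf \<and> \<delta>inf \<le> \<delta>sup \<and>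
        (\<forall>v. \<delta>inf * (norm v)\<^sup>2 \<le> blinfun_apply (blinfun_apply (F2 ustar) v) v \<and>
             blinfun_apply (blinfun_apply (F2 ustar) v) v \<le> \<delta>sup * (norm v)\<^sup>2))"


section \<open>The Barzilai-Borwein iteration\<close>

(* The inner product is a parameter so that the same definitions serve the continuous problem
   and every discrete problem. *)

datatype bb_rule = BB1 | BB2

definition bb_alpha ::
  "('v \<Rightarrow> 'v \<Rightarrow> real) \<Rightarrow> ('v \<Rightarrow> 'v) \<Rightarrow> bb_rule \<Rightarrow> (nat \<Rightarrow> 'v::real_vector) \<Rightarrow> nat \<Rightarrow> real"
  where
  "bb_alpha ip G r u k =
     (let S = u k - u (k - 1); Y = G (u k) - G (u (k - 1))
      in case r of BB1 \<Rightarrow> ip S Y / ip S S | BB2 \<Rightarrow> ip Y Y / ip S Y)"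

(* r k is the formula used in step k. The algorithm stops at the first k \<ge> 1 with G (u k) = 0;
   values of u beyond the stopping index are not constrained.
   If a denominator vanishes or alpha is 0, then 1 / alpha is 0 by the convention x / 0 = 0.
   The iteration then stalls forever at a point with nonzero gradient, which r_linear below
   excludes. *)

definition bb_sequence ::
  "('v \<Rightarrow> 'v \<Rightarrow> real) \<Rightarrow> ('v \<Rightarrow> 'v) \<Rightarrow> (nat \<Rightarrow> bb_rule) \<Rightarrow> (nat \<Rightarrow> 'v::real_vector) \<Rightarrow> bool"
  where
  "bb_sequence ip G r u \<longleftrightarrow>
     (\<forall>k\<ge>1. G (u k) \<noteq> 0 \<longrightarrow>
        u (Suc k) = u k - (1 / bb_alpha ip G (r k) u k) *\<^sub>R G (u k))"

definition generated :: "('v \<Rightarrow> 'v) \<Rightarrow> (nat \<Rightarrow> 'v::real_vector) \<Rightarrow> nat \<Rightarrow> bool"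
  where
  "generated G u k \<longleftrightarrow> (\<forall>j. 1 \<le> j \<and> j < k \<longrightarrow> G (u j) \<noteq> 0)"

definition r_linear :: "('a::real_inner \<Rightarrow> 'a) \<Rightarrow> 'a \<Rightarrow> (nat \<Rightarrow> 'a) \<Rightarrow> bool"
  where
  "r_linear G ustar u \<longleftrightarrow>
     (\<exists>c1>0. \<exists>c2>0. \<exists>\<theta>>0. \<theta> < 1 \<and>
        (\<forall>k\<ge>1. generated G u k \<longrightarrow>
           norm (u k - ustar) \<le> c1 * \<theta> ^ k * norm (u 1 - ustar) \<and>
           norm (G (u k)) \<le> c2 * \<theta> ^ k * norm (G (u 1))))"

(* The minimum over {1,2,...} as an extended natural number, with value \<infinity> for the empty set.
   An index beyond the stopping index never is the minimum, because the gradient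
   vanishes at the stopping index. *)

definition iteration_count ::
  "('v \<Rightarrow> 'v \<Rightarrow> real) \<Rightarrow> ('v \<Rightarrow> 'v) \<Rightarrow> (nat \<Rightarrow> 'v) \<Rightarrow> real \<Rightarrow> enat"
  where
  "iteration_count ip G u \<epsilon> = Inf (enat ` {k. 1 \<le> k \<and> sqrt (ip (G (u k)) (G (u k))) < \<epsilon>})"


section \<open>The discrete problems\<close>

(* The dimension of the discrete spaces varies with h. They are therefore finite-dimensional
   subspaces V h of one ambient real vector space, each with its own inner product ip h that is
   meaningful on V h only. No relation between V h and V h' is assumed. *)

definition inner_product_on :: "'b::real_vector set \<Rightarrow> ('b \<Rightarrow> 'b \<Rightarrow> real) \<Rightarrow> bool"
  where
  "inner_product_on V ip \<longleftrightarrow>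
     (\<forall>x\<in>V. \<forall>y\<in>V. ip x y = ip y x) \<and>
     (\<forall>x\<in>V. \<forall>y\<in>V. \<forall>z\<in>V. ip (x + y) z = ip x z + ip y z) \<and>
     (\<forall>c. \<forall>x\<in>V. \<forall>y\<in>V. ip (c *\<^sub>R x) y = c * ip x y) \<and>
     (\<forall>x\<in>V. x \<noteq> 0 \<longrightarrow> 0 < ip x x)"

definition finite_dim_hilbert_on :: "'b::real_vector set \<Rightarrow> ('b \<Rightarrow> 'b \<Rightarrow> real) \<Rightarrow> bool"
  where
  "finite_dim_hilbert_on V ip \<longleftrightarrow> (\<exists>B. finite B \<and> span B = V) \<and> inner_product_on V ip"

definition ip_topology :: "'b::real_vector set \<Rightarrow> ('b \<Rightarrow> 'b \<Rightarrow> real) \<Rightarrow> 'b topology"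
  where
  "ip_topology V ip = Metric_space.mtopology V (\<lambda>x y. sqrt (ip (x - y) (x - y)))"

definition discrete_family ::
  "(real \<Rightarrow> 'b::real_vector set) \<Rightarrow> (real \<Rightarrow> 'b \<Rightarrow> 'b \<Rightarrow> real) \<Rightarrow> (real \<Rightarrow> 'b \<Rightarrow> 'b) \<Rightarrow>
   (real \<Rightarrow> 'b \<Rightarrow> 'a::real_vector) \<Rightarrow> bool"
  where
  "discrete_family V ip Gh P \<longleftrightarrow>
     (\<forall>h>0. finite_dim_hilbert_on (V h) (ip h) \<and>
        Gh h ` V h \<subseteq> V h \<and>
        continuous_map (ip_topology (V h) (ip h)) (ip_topology (V h) (ip h)) (Gh h) \<and>
        (\<forall>x\<in>V h. \<forall>y\<in>V h. P h (x + y) = P h x + P h y) \<and>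
        (\<forall>c. \<forall>x\<in>V h. P h (c *\<^sub>R x) = c *\<^sub>R P h x))"

definition prolong_tendsto ::
  "(real \<Rightarrow> 'b set) \<Rightarrow> (real \<Rightarrow> 'b \<Rightarrow> 'a::real_normed_vector) \<Rightarrow> (real \<Rightarrow> 'b) \<Rightarrow> 'a \<Rightarrow> bool"
  where
  "prolong_tendsto V P x u \<longleftrightarrow>
     (\<forall>h>0. x h \<in> V h) \<and> ((\<lambda>h. norm (P h (x h) - u)) \<longlongrightarrow> 0) (at_right 0)"

definition assumption_A1 ::
  "(real \<Rightarrow> 'b set) \<Rightarrow> (real \<Rightarrow> 'b \<Rightarrow> 'b \<Rightarrow> real) \<Rightarrow> (real \<Rightarrow> 'b \<Rightarrow> 'a::real_inner) \<Rightarrow> bool"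
  where
  "assumption_A1 V ip P \<longleftrightarrow>
     (\<forall>x z u v. prolong_tendsto V P x u \<longrightarrow> prolong_tendsto V P z v \<longrightarrow>
        ((\<lambda>h. ip h (x h) (z h)) \<longlongrightarrow> u \<bullet> v) (at_right 0))"

definition assumption_A2 ::
  "(real \<Rightarrow> 'b set) \<Rightarrow> (real \<Rightarrow> 'b \<Rightarrow> 'b) \<Rightarrow> (real \<Rightarrow> 'b \<Rightarrow> 'a::real_inner) \<Rightarrow>
   ('a \<Rightarrow> 'a) \<Rightarrow> 'a \<Rightarrow> (nat \<Rightarrow> 'a) \<Rightarrow> bool"
  where
  "assumption_A2 V Gh P G ustar u \<longleftrightarrow>
     G ustar = 0 \<and>
     (\<exists>N. ustar \<in> interior N \<and> (\<forall>k. generated G u k \<longrightarrow> u k \<in> N) \<and>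
        (\<forall>x w. w \<in> N \<longrightarrow> prolong_tendsto V P x w \<longrightarrow>
           prolong_tendsto V P (\<lambda>h. Gh h (x h)) (G w)))"

end

theory Submission
  imports Defs
begin

text \<open>
  Write \<open>m\<close> for the continuous iteration count with tolerance \<open>\<epsilon>\<close>. It is finite because linear
  convergence drives the gradient norms to zero, and no gradient vanishes before index \<open>m\<close>. Only
  the finitely many iterates up to index \<open>m\<close> matter, and each of them is the limit of the
  corresponding discrete iterates as \<open>h\<close> tends to zero: one step is built from the
  gradient, inner products and divisions, A2 passes to the limit in the gradient and A1 in the
  inner products (\<open>bb_iterates_tendsto\<close>). By A1 again, the discrete gradient norms with index at
  most \<open>m\<close> converge. Hence, for all small \<open>h\<close>, the norm with index \<open>m\<close> lies below \<open>\<epsilon>\<close>,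
  which bounds the discrete count by \<open>m\<close>, and all these norms are \<open>\<delta>\<close>-close to their limits, so that
  an index up to \<open>m\<close> that satisfies the discrete test with \<open>\<epsilon>\<close> satisfies the continuous one with \<open>\<epsilon> + \<delta>\<close>.

  The delicate point is that the denominators in a step must not vanish in the limit. Near the minimizer
  one could obtain this from the convexity of the functional, but the convergence of
  the sequence gives it directly. If a numerator or denominator of the quotient \<open>\<alpha>\<close> vanishes, then
  \<open>\<alpha> = 0\<close> and \<open>1 / \<alpha> = 0\<close> by the convention \<open>x / 0 = 0\<close>. The next difference of iterates is then
  zero, so is the next quotient, and the sequence stays forever at a point with nonzero gradient,
  which contradicts linear convergence (\<open>bb_alpha_nonzero\<close>).
\<close>

section \<open>Limits of prolongated families\<close>

lemma prolong_tendsto_iff: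
  fixes P :: "real \<Rightarrow> 'b \<Rightarrow> 'a::real_normed_vector"
  shows "prolong_tendsto V P x u \<longleftrightarrow>
    (\<forall>h>0. x h \<in> V h) \<and> ((\<lambda>h. P h (x h)) \<longlongrightarrow> u) (at_right 0)"
  unfolding prolong_tendsto_def by (simp add: tendsto_norm_zero_iff LIM_zero_iff)

lemma discrete_family_subspace:
  assumes "discrete_family V ip Gh P" "h > 0"
  shows "subspace (V h)"
  using assms unfolding discrete_family_def finite_dim_hilbert_on_def
  by (metis subspace_span)

lemma prolong_tendsto_diff_scaleR:
  fixes P :: "real \<Rightarrow> 'b::real_vector \<Rightarrow> 'a::real_normed_vector"
  assumes fam: "discrete_family V ip Gh P"
    and x: "prolong_tendsto V P x u" and y: "prolong_tendsto V P y w"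
    and c: "(c \<longlongrightarrow> c0) (at_right 0)"
  shows "prolong_tendsto V P (\<lambda>h. x h - c h *\<^sub>R y h) (u - c0 *\<^sub>R w)"
proof -
  have mem: "x h \<in> V h" "y h \<in> V h" if "h > 0" for h
    using x y that by (auto simp: prolong_tendsto_iff)
  have P_eq: "P h (x h - c h *\<^sub>R y h) = P h (x h) - c h *\<^sub>R P h (y h)" if h: "h > 0" for h
  proof -
    have "(- c h) *\<^sub>R y h \<in> V h"
      using discrete_family_subspace[OF fam h] mem[OF h] by (intro subspace_scale)
    then have "P h (x h + (- c h) *\<^sub>R y h) = P h (x h) + (- c h) *\<^sub>R P h (y h)"
      using fam mem[OF h] h unfolding discrete_family_def by metis
    then show ?thesis by simp
  qed
  have "((\<lambda>h. P h (x h) - c h *\<^sub>R P h (y h)) \<longlongrightarrow> u - c0 *\<^sub>R w) (at_right 0)"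
    using x y c unfolding prolong_tendsto_iff by (intro tendsto_intros) auto
  moreover have "\<forall>\<^sub>F h in at_right 0.
      P h (x h - c h *\<^sub>R y h) = P h (x h) - c h *\<^sub>R P h (y h)"
    using eventually_at_right_less[of "0::real"] by eventually_elim (rule P_eq)
  ultimately have "((\<lambda>h. P h (x h - c h *\<^sub>R y h)) \<longlongrightarrow> u - c0 *\<^sub>R w) (at_right 0)"
    by (simp cong: tendsto_cong)
  moreover have "x h - c h *\<^sub>R y h \<in> V h" if "h > 0" for h
    using discrete_family_subspace[OF fam that] mem[OF that]
    by (intro subspace_diff subspace_scale)
  ultimately show ?thesis by (simp add: prolong_tendsto_iff)
qed

lemma prolong_tendsto_diff:
  fixes P :: "real \<Rightarrow> 'b::real_vector \<Rightarrow> 'a::real_normed_vector"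
  assumes "discrete_family V ip Gh P"
    and "prolong_tendsto V P x u" "prolong_tendsto V P y w"
  shows "prolong_tendsto V P (\<lambda>h. x h - y h) (u - w)"
  using prolong_tendsto_diff_scaleR[OF assms tendsto_const[of 1]] by simp

text \<open>The recursion for the discrete iterates is available for small \<open>h\<close> only, whereas membership in
  the discrete spaces is part of the convergence notion for every \<open>h\<close>.\<close>

lemma prolong_tendsto_cong:
  fixes P :: "real \<Rightarrow> 'b \<Rightarrow> 'a::real_normed_vector"
  assumes "prolong_tendsto V P x u"
    and "\<forall>\<^sub>F h in at_right 0. y h = x h" and "\<And>h. h > 0 \<Longrightarrow> y h \<in> V h"
  shows "prolong_tendsto V P y u"
proof -
  have "\<forall>\<^sub>F h in at_right 0. P h (y h) = P h (x h)"
    using assms(2) by eventually_elim simp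
  then show ?thesis
    using assms(1,3) by (simp add: prolong_tendsto_iff cong: tendsto_cong)
qed

section \<open>Nondegeneracy of the step sizes\<close>

lemma bb_alpha_stationary: "u k = u (k - 1) \<Longrightarrow> bb_alpha (\<bullet>) G r u k = 0"
  by (auto simp: bb_alpha_def split: bb_rule.split)

text \<open>The convention \<open>1 / 0 = 0\<close> turns a zero quotient into a zero step. After it the difference of
  consecutive iterates is zero, which makes the next quotient zero again.\<close>

lemma bb_sequence_stalls:
  assumes bb: "bb_sequence (\<bullet>) G r u" and "1 \<le> k" and zero: "bb_alpha (\<bullet>) G (r k) u k = 0"
    and nz: "G (u k) \<noteq> 0"
  shows "u (k + j) = u k"
proof -
  have "u (k + j) = u k \<and> bb_alpha (\<bullet>) G (r (k + j)) u (k + j) = 0"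
  proof (induction j)
    case 0
    then show ?case using zero by simp
  next
    case (Suc j)
    then have "u (Suc (k + j)) = u (k + j)"
      using bb nz \<open>1 \<le> k\<close> unfolding bb_sequence_def by simp
    then show ?case
      using Suc bb_alpha_stationary[of u "Suc (k + j)"] by simp
  qed
  then show ?thesis ..
qed

lemma r_linear_gradient_tendsto_zero:
  assumes "r_linear G ustar u" and nz: "\<And>k. 1 \<le> k \<Longrightarrow> G (u k) \<noteq> 0"
  shows "(\<lambda>k. norm (G (u k))) \<longlonglongrightarrow> 0"
proof -
  obtain c \<theta> where \<theta>: "0 < \<theta>" "\<theta> < (1::real)"
    and bound: "\<And>k. 1 \<le> k \<Longrightarrow> norm (G (u k)) \<le> c * \<theta> ^ k * norm (G (u 1))"
    using assms unfolding r_linear_def generated_def by metis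
  have "(\<lambda>k. c * \<theta> ^ k * norm (G (u 1))) \<longlonglongrightarrow> c * 0 * norm (G (u 1))"
    using \<theta> by (intro tendsto_intros LIMSEQ_power_zero) auto
  then have lim: "(\<lambda>k. c * \<theta> ^ k * norm (G (u 1))) \<longlonglongrightarrow> 0" by simp
  show ?thesis
  proof (rule tendsto_sandwich[OF _ _ tendsto_const lim])
    show "\<forall>\<^sub>F k in sequentially. norm (G (u k)) \<le> c * \<theta> ^ k * norm (G (u 1))"
      using eventually_ge_at_top[of 1] by eventually_elim (rule bound)
  qed simp
qed

lemma r_linear_gradient_small:
  assumes "r_linear G ustar u" and "0 < \<epsilon>"
  shows "\<exists>k\<ge>1. norm (G (u k)) < \<epsilon>"
proof (cases "\<exists>k\<ge>1. G (u k) = 0")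
  case True
  then show ?thesis using \<open>0 < \<epsilon>\<close> by (metis norm_zero)
next
  case False
  then have "\<forall>\<^sub>F k in sequentially. norm (G (u k)) < \<epsilon>"
    using r_linear_gradient_tendsto_zero[OF assms(1)] \<open>0 < \<epsilon>\<close>
    by (intro order_tendstoD(2)) auto
  then have "\<forall>\<^sub>F k in sequentially. 1 \<le> k \<and> norm (G (u k)) < \<epsilon>"
    using eventually_ge_at_top[of 1] by eventually_elim simp
  then show ?thesis by (auto dest: eventually_happens)
qed

text \<open>Since \<open>x / 0 = 0\<close>, this says at once that the numerator and the denominator of the quotient are
  nonzero, as the limits of the quotient and of its reciprocal require. Otherwise the sequence stalls
  without ever stopping, and linear convergence makes its constant nonzero gradient norm tend to zero.\<close>

lemma bb_alpha_nonzero: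
  assumes bb: "bb_sequence (\<bullet>) G r u" and lin: "r_linear G ustar u"
    and gen: "generated G u k" and "1 \<le> k" and nz: "G (u k) \<noteq> 0"
  shows "bb_alpha (\<bullet>) G (r k) u k \<noteq> 0"
proof
  assume zero: "bb_alpha (\<bullet>) G (r k) u k = 0"
  note stall = bb_sequence_stalls[OF bb \<open>1 \<le> k\<close> zero nz]
  have "G (u j) \<noteq> 0" if "1 \<le> j" for j
  proof (cases "j < k")
    case True
    then show ?thesis using gen that by (simp add: generated_def)
  next
    case False
    then show ?thesis using stall[of "j - k"] nz by simp
  qed
  then have "(\<lambda>j. norm (G (u j))) \<longlonglongrightarrow> 0"
    by (rule r_linear_gradient_tendsto_zero[OF lin])
  then have "(\<lambda>j. norm (G (u (j + k)))) \<longlonglongrightarrow> 0"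
    by (rule LIMSEQ_ignore_initial_segment)
  then have "norm (G (u k)) = 0"
    using stall by (simp add: add.commute LIMSEQ_const_iff)
  then show False using nz by simp
qed

section \<open>Convergence of the discrete iterates\<close>

lemma assumption_A1_D:
  assumes "assumption_A1 V ip P" "prolong_tendsto V P x u" "prolong_tendsto V P z v"
  shows "((\<lambda>h. ip h (x h) (z h)) \<longlongrightarrow> u \<bullet> v) (at_right 0)"
  using assms unfolding assumption_A1_def by blast

lemma bb_alpha_tendsto:
  fixes P :: "real \<Rightarrow> 'b::real_vector \<Rightarrow> 'a::real_inner"
  assumes fam: "discrete_family V ip Gh P" and A1: "assumption_A1 V ip P"
    and x: "prolong_tendsto V P (\<lambda>h. uh h k) (u k)"
      "prolong_tendsto V P (\<lambda>h. uh h (k - 1)) (u (k - 1))"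
    and g: "prolong_tendsto V P (\<lambda>h. Gh h (uh h k)) (G (u k))"
      "prolong_tendsto V P (\<lambda>h. Gh h (uh h (k - 1))) (G (u (k - 1)))"
    and nz: "bb_alpha (\<bullet>) G r u k \<noteq> 0"
  shows "((\<lambda>h. bb_alpha (ip h) (Gh h) r (uh h) k) \<longlongrightarrow> bb_alpha (\<bullet>) G r u k) (at_right 0)"
proof -
  note S = prolong_tendsto_diff[OF fam x] and Y = prolong_tendsto_diff[OF fam g]
  show ?thesis
  proof (cases r)
    case BB1
    then show ?thesis
      using nz assumption_A1_D[OF A1 S Y] assumption_A1_D[OF A1 S S]
      by (auto simp: bb_alpha_def Let_def intro!: tendsto_divide)
  next
    case BB2
    then show ?thesis
      using nz assumption_A1_D[OF A1 Y Y] assumption_A1_D[OF A1 S Y]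
      by (auto simp: bb_alpha_def Let_def intro!: tendsto_divide)
  qed
qed

lemma discrete_inner_zero:
  assumes "discrete_family V ip Gh P" "h > 0"
  shows "ip h 0 0 = 0"
proof -
  have "0 \<in> V h"
    using discrete_family_subspace[OF assms] by (rule subspace_0)
  moreover have "inner_product_on (V h) (ip h)"
    using assms by (simp add: discrete_family_def finite_dim_hilbert_on_def)
  ultimately have "ip h (0 *\<^sub>R 0) 0 = 0 * ip h 0 0"
    unfolding inner_product_on_def by blast
  then show ?thesis by simp
qed

text \<open>A discrete sequence may stop at any index at which its gradient vanishes, and its later values are
  then arbitrary. By A1 a nonzero limit of the discrete gradients excludes this for small \<open>h\<close>.\<close>

lemma eventually_nonzero_of_prolong_tendsto:
  fixes P :: "real \<Rightarrow> 'b::real_vector \<Rightarrow> 'a::real_inner"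
  assumes fam: "discrete_family V ip Gh P" and A1: "assumption_A1 V ip P"
    and x: "prolong_tendsto V P x w" and "w \<noteq> 0"
  shows "\<forall>\<^sub>F h in at_right 0. x h \<noteq> 0"
proof -
  have "\<forall>\<^sub>F h in at_right 0. 0 < ip h (x h) (x h)"
    using assumption_A1_D[OF A1 x x] \<open>w \<noteq> 0\<close> by (intro order_tendstoD(1)) auto
  then show ?thesis
    using eventually_at_right_less[of "0::real"]
    by eventually_elim (use discrete_inner_zero[OF fam] in fastforce)
qed

text \<open>The induction carries two consecutive indices because a step uses two previous iterates. A2
  applies at each of them since the neighborhood in A2 contains all generated iterates.\<close>

lemma bb_iterates_tendsto:
  fixes u :: "nat \<Rightarrow> 'a::real_inner" and V :: "real \<Rightarrow> 'b::real_vector set"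
  assumes bb: "bb_sequence (\<bullet>) G r u" and lin: "r_linear G ustar u"
    and fam: "discrete_family V ip Gh P" and A1: "assumption_A1 V ip P"
    and A2: "assumption_A2 V Gh P G ustar u"
    and mem: "\<And>h k. h > 0 \<Longrightarrow> uh h k \<in> V h"
    and bbh: "\<And>h. h > 0 \<Longrightarrow> bb_sequence (ip h) (Gh h) r (uh h)"
    and init: "prolong_tendsto V P (\<lambda>h. uh h 0) (u 0)" "prolong_tendsto V P (\<lambda>h. uh h 1) (u 1)"
    and gen: "generated G u k"
  shows "prolong_tendsto V P (\<lambda>h. uh h k) (u k)"
    and "prolong_tendsto V P (\<lambda>h. Gh h (uh h k)) (G (u k))"
proof -
  have grad: "prolong_tendsto V P (\<lambda>h. Gh h (uh h j)) (G (u j))"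
    if "generated G u j" "prolong_tendsto V P (\<lambda>h. uh h j) (u j)" for j
    using A2 that unfolding assumption_A2_def by blast
  have gen_le: "generated G u j" if "j \<le> i" "generated G u i" for i j
    using that by (auto simp: generated_def)
  have "prolong_tendsto V P (\<lambda>h. uh h k) (u k) \<and>
      prolong_tendsto V P (\<lambda>h. uh h (k - 1)) (u (k - 1))"
    using gen
  proof (induction k)
    case 0
    then show ?case using init by simp
  next
    case (Suc k)
    then have gk: "generated G u k" by (auto intro: gen_le[of k "Suc k"])
    then have xk: "prolong_tendsto V P (\<lambda>h. uh h k) (u k)"
      and xk': "prolong_tendsto V P (\<lambda>h. uh h (k - 1)) (u (k - 1))"
      using Suc.IH by auto
    show ?case
    proof (cases "k = 0")
      case True
      then show ?thesis using init by simp
    next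
      case False
      then have k: "1 \<le> k" by simp
      have nz: "G (u k) \<noteq> 0" using Suc.prems k by (simp add: generated_def)
      have yk: "prolong_tendsto V P (\<lambda>h. Gh h (uh h k)) (G (u k))"
        using gk xk by (rule grad)
      have yk': "prolong_tendsto V P (\<lambda>h. Gh h (uh h (k - 1))) (G (u (k - 1)))"
        by (rule grad[OF gen_le[OF _ gk] xk']) simp
      define a where "a h = 1 / bb_alpha (ip h) (Gh h) (r k) (uh h) k" for h
      have alpha: "bb_alpha (\<bullet>) G (r k) u k \<noteq> 0"
        by (rule bb_alpha_nonzero[OF bb lin gk k nz])
      have "(a \<longlongrightarrow> 1 / bb_alpha (\<bullet>) G (r k) u k) (at_right 0)"
        unfolding a_def
        by (intro tendsto_divide tendsto_const bb_alpha_tendsto[OF fam A1 xk xk' yk yk' alpha] alpha)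
      from prolong_tendsto_diff_scaleR[OF fam xk yk this]
      have step: "prolong_tendsto V P (\<lambda>h. uh h k - a h *\<^sub>R Gh h (uh h k)) (u (Suc k))"
        using bb k nz by (simp add: bb_sequence_def)
      have "\<forall>\<^sub>F h in at_right 0. uh h (Suc k) = uh h k - a h *\<^sub>R Gh h (uh h k)"
        using eventually_nonzero_of_prolong_tendsto[OF fam A1 yk nz]
          eventually_at_right_less[of "0::real"]
        by eventually_elim (use bbh k in \<open>simp add: bb_sequence_def a_def\<close>)
      then have "prolong_tendsto V P (\<lambda>h. uh h (Suc k)) (u (Suc k))"
        by (rule prolong_tendsto_cong[OF step]) (rule mem)
      then show ?thesis using xk by simp
    qed
  qed
  then show "prolong_tendsto V P (\<lambda>h. uh h k) (u k)" ..
  then show "prolong_tendsto V P (\<lambda>h. Gh h (uh h k)) (G (u k))"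
    by (rule grad[OF gen])
qed

section \<open>Iteration counts\<close>

lemma iteration_count_le:
  "1 \<le> k \<Longrightarrow> sqrt (ip (G (u k)) (G (u k))) < \<epsilon> \<Longrightarrow> iteration_count ip G u \<epsilon> \<le> enat k"
  unfolding iteration_count_def by (intro Inf_lower) auto

lemma le_iteration_countI:
  "(\<And>k. 1 \<le> k \<Longrightarrow> sqrt (ip (G (u k)) (G (u k))) < \<epsilon> \<Longrightarrow> n \<le> enat k) \<Longrightarrow>
    n \<le> iteration_count ip G u \<epsilon>"
  unfolding iteration_count_def by (intro Inf_greatest) auto

lemma iteration_count_eq_Least:
  assumes "\<exists>k\<ge>1. norm (G (u k)) < \<epsilon>"
  shows "iteration_count (\<bullet>) G u \<epsilon> = enat (LEAST k. 1 \<le> k \<and> norm (G (u k)) < \<epsilon>)"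
  using LeastI_ex[OF assms]
  by (intro antisym iteration_count_le le_iteration_countI)
    (auto simp: norm_eq_sqrt_inner intro: Least_le)

theorem theorem5:
  fixes F :: "'a::{real_inner,complete_space} \<Rightarrow> real"
    and F1 :: "'a \<Rightarrow> ('a \<Rightarrow>\<^sub>L real)"
    and F2 :: "'a \<Rightarrow> ('a \<Rightarrow>\<^sub>L ('a \<Rightarrow>\<^sub>L real))"
    and G :: "'a \<Rightarrow> 'a"
    and ustar :: 'a
    and r :: "nat \<Rightarrow> bb_rule"
    and u :: "nat \<Rightarrow> 'a"
    and V :: "real \<Rightarrow> 'b::real_vector set"
    and ip :: "real \<Rightarrow> 'b \<Rightarrow> 'b \<Rightarrow> real"
    and Gh :: "real \<Rightarrow> 'b \<Rightarrow> 'b"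
    and P :: "real \<Rightarrow> 'b \<Rightarrow> 'a"
    and uh :: "real \<Rightarrow> nat \<Rightarrow> 'b"
    and \<epsilon> \<delta> :: real
  assumes "C2_with_gradient F F1 F2 G"
    and "assumption_A0 F F2 ustar"
    and "u 1 \<noteq> u 0"
    and "bb_sequence (\<bullet>) G r u"
    and "r_linear G ustar u"
    and "discrete_family V ip Gh P"
    and "assumption_A1 V ip P"
    and "assumption_A2 V Gh P G ustar u"
    and "\<And>h k. h > 0 \<Longrightarrow> uh h k \<in> V h"
    and "\<And>h. h > 0 \<Longrightarrow> uh h 1 \<noteq> uh h 0"
    and "\<And>h. h > 0 \<Longrightarrow> bb_sequence (ip h) (Gh h) r (uh h)"
    and "prolong_tendsto V P (\<lambda>h. uh h 0) (u 0)"
    and "prolong_tendsto V P (\<lambda>h. uh h 1) (u 1)"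
    and "\<epsilon> > 0" and "\<delta> > 0"
  shows "\<exists>h\<^sub>0>0. \<forall>h\<in>{0<..h\<^sub>0}.
           iteration_count (\<bullet>) G u (\<epsilon> + \<delta>) \<le> iteration_count (ip h) (Gh h) (uh h) \<epsilon> \<and>
           iteration_count (ip h) (Gh h) (uh h) \<epsilon> \<le> iteration_count (\<bullet>) G u \<epsilon> \<and>
           iteration_count (\<bullet>) G u \<epsilon> < \<infinity>"
proof -
  define m where "m = (LEAST k. 1 \<le> k \<and> norm (G (u k)) < \<epsilon>)"
  have small: "\<exists>k\<ge>1. norm (G (u k)) < \<epsilon>"
    using assms(5,14) by (rule r_linear_gradient_small)
  have count: "iteration_count (\<bullet>) G u \<epsilon> = enat m"
    unfolding m_def using small by (rule iteration_count_eq_Least)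
  have m: "1 \<le> m" "norm (G (u m)) < \<epsilon>"
    using LeastI_ex[OF small] by (auto simp: m_def)
  have gen: "generated G u k" if "k \<le> m" for k
    unfolding generated_def
    using that \<open>0 < \<epsilon>\<close> by (auto simp: m_def dest!: not_less_Least[OF less_le_trans])
  define N where "N h k = sqrt (ip h (Gh h (uh h k)) (Gh h (uh h k)))" for h k
  have N_lim: "((\<lambda>h. N h k) \<longlongrightarrow> norm (G (u k))) (at_right 0)" if "k \<le> m" for k
  proof -
    have "prolong_tendsto V P (\<lambda>h. Gh h (uh h k)) (G (u k))"
      by (rule bb_iterates_tendsto(2)[OF assms(4-9,11-13) gen[OF that]])
    from assumption_A1_D[OF assms(7) this this] show ?thesis
      unfolding N_def norm_eq_sqrt_inner by (rule tendsto_real_sqrt)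
  qed
  have "\<forall>\<^sub>F h in at_right 0. N h m < \<epsilon>"
    using m by (intro order_tendstoD(2)[OF N_lim]) auto
  moreover have "\<forall>\<^sub>F h in at_right 0. \<forall>k\<in>{..m}. norm (G (u k)) - \<delta> < N h k"
    using \<open>\<delta> > 0\<close> by (intro eventually_ball_finite ballI order_tendstoD(1)[OF N_lim]) auto
  ultimately have "\<forall>\<^sub>F h in at_right 0.
      N h m < \<epsilon> \<and> (\<forall>k\<le>m. norm (G (u k)) - \<delta> < N h k)"
    by eventually_elim simp
  then obtain b where b: "b > 0"
    and close: "\<And>h. 0 < h \<Longrightarrow> h < b \<Longrightarrow> N h m < \<epsilon>"
      "\<And>h k. 0 < h \<Longrightarrow> h < b \<Longrightarrow> k \<le> m \<Longrightarrow> norm (G (u k)) - \<delta> < N h k"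
    unfolding eventually_at_right_field by blast
  have "iteration_count (\<bullet>) G u (\<epsilon> + \<delta>) \<le> iteration_count (ip h) (Gh h) (uh h) \<epsilon> \<and>
      iteration_count (ip h) (Gh h) (uh h) \<epsilon> \<le> enat m" if h: "h \<in> {0<..b/2}" for h
  proof
    have hb: "0 < h" "h < b" using h b by auto
    show "iteration_count (ip h) (Gh h) (uh h) \<epsilon> \<le> enat m"
      using m close(1)[OF hb] by (intro iteration_count_le) (auto simp: N_def)
    show "iteration_count (\<bullet>) G u (\<epsilon> + \<delta>) \<le> iteration_count (ip h) (Gh h) (uh h) \<epsilon>"
    proof (rule le_iteration_countI)
      fix k :: nat
      assume k: "1 \<le> k" "sqrt (ip h (Gh h (uh h k)) (Gh h (uh h k))) < \<epsilon>"
      \<comment> \<open>Nothing is known about the discrete iterates beyond index \<open>m\<close>, so for large \<open>k\<close> the index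
        \<open>m\<close> takes its place in the continuous test.\<close>
      have "norm (G (u (min k m))) < \<epsilon> + \<delta>"
        using k m \<open>\<delta> > 0\<close> close(2)[OF hb, of k] by (auto simp: min_def N_def)
      then have "iteration_count (\<bullet>) G u (\<epsilon> + \<delta>) \<le> enat (min k m)"
        using k m by (intro iteration_count_le) (auto simp: norm_eq_sqrt_inner)
      also have "\<dots> \<le> enat k" by simp
      finally show "iteration_count (\<bullet>) G u (\<epsilon> + \<delta>) \<le> enat k" .
    qed
  qed
  then show ?thesis
    using b by (intro exI[of _ "b/2"]) (simp add: count)
qed

end
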